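(* Let $n\ge 2$ and let $G=D_{2^{n+1}}$ be the dihedral group of order $2^{n+1}$, with generators $\sigma,\tau$ and relations $\tau\sigma=\sigma^{-1}\tau$, $\tau^2=\sigma^{2^n}=1$. Put $u=\sigma^{2^{n-1}}$, let $U$ be the normal subgroup generated by $\sigma^2$ and $\tau$, and let $U_2$ be the elementary abelian subgroup generated by $u$ and $\sigma\tau$. Let $G$ act by ring automorphisms on a ring $R$, let $x,x_2\in R$ satisfy $N_U(x)=1$ and $N_{U_2}(x_2)=1$, and set $$b(\sigma)=(\sigma+u\tau)(x_2),\qquad b(\tau)=(\tau-1)(1+u)(x_2),\qquad b(\sigma^2)=(1+\sigma)b(\sigma)-1 .$$ Then one can find an element $w\in R$ such that $$b(\sigma^2)=(\sigma^2-1)w\quad\text{and}\quad b(\tau)=(\tau-1)w,$$ and $w$ can be expressed as a noncommutative polynomial with integer coefficients in terms of the norm one element $x$, the elements of $U$, and the values $b(\sigma)$, $b(\tau)$. Consequently, the element $a=b(\sigma)+(1-\sigma)(w)$ is $U$-invariant and satisfies $N_{G/U}(a)=(1+\sigma)(a)=1$. Hence $N_G(y)=1$ for $y=ax$.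
   Context: Rings are associative with unit, not necessarily commutative. For a finite group $V$ acting on $R$ by ring automorphisms, $N_V(r)=\sum_{g\in V}g(r)$. The action of $G$ on $R$ is extended additively to an action of the group ring $\mathbf Z[G]$ on $R$. The quotient $G/U$ is cyclic of order $2$, generated by the class of $\sigma$, and acts on the subring $R^U$ of $U$-invariant elements. *)

theory Defs
  imports "HOL-Algebra.Algebra" "HOL-Library.Poly_Mapping"
begin

(* G is generated by \<sigma> and \<tau> subject to the dihedral relations. The order condition says that
   no further relations hold, i.e. that this is the presentation of the dihedral group. *)
definition dihedral_generators ::
    "('g, 'm) monoid_scheme \<Rightarrow> nat \<Rightarrow> 'g \<Rightarrow> 'g \<Rightarrow> bool" where
  "dihedral_generators G n \<sigma> \<tau> \<longleftrightarrow>
     group G \<and> order G = 2 ^ (n + 1) \<and>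
     \<sigma> \<in> carrier G \<and> \<tau> \<in> carrier G \<and> generate G {\<sigma>, \<tau>} = carrier G \<and>
     \<tau> \<otimes>\<^bsub>G\<^esub> \<sigma> = inv\<^bsub>G\<^esub> \<sigma> \<otimes>\<^bsub>G\<^esub> \<tau> \<and>
     \<tau> [^]\<^bsub>G\<^esub> (2::nat) = \<one>\<^bsub>G\<^esub> \<and> \<sigma> [^]\<^bsub>G\<^esub> ((2::nat) ^ n) = \<one>\<^bsub>G\<^esub>"

definition acts_by_ring_automorphisms ::
    "('g, 'm) monoid_scheme \<Rightarrow> ('r, 'k) ring_scheme \<Rightarrow> ('g \<Rightarrow> 'r \<Rightarrow> 'r) \<Rightarrow> bool" where
  "acts_by_ring_automorphisms G R \<phi> \<longleftrightarrow>
     group_action G (carrier R) \<phi> \<and> (\<forall>g\<in>carrier G. \<phi> g \<in> ring_iso R R)"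

definition action_norm :: "('r, 'k) ring_scheme \<Rightarrow> ('v \<Rightarrow> 'r \<Rightarrow> 'r) \<Rightarrow> 'v set \<Rightarrow> 'r \<Rightarrow> 'r" where
  "action_norm R \<psi> V r = (\<Oplus>\<^bsub>R\<^esub>g\<in>V. \<psi> g r)"

definition fixed_subring :: "('r, 'k) ring_scheme \<Rightarrow> ('g \<Rightarrow> 'r \<Rightarrow> 'r) \<Rightarrow> 'g set \<Rightarrow> 'r set" where
  "fixed_subring R \<phi> U = {r \<in> carrier R. \<forall>g\<in>U. \<phi> g r = r}"

(* Action of a coset C \<in> G Mod U on a U-invariant element: all representatives of C
   send it to the same element, which is the one selected here. *)
definition quotient_action :: "('g \<Rightarrow> 'r \<Rightarrow> 'r) \<Rightarrow> 'g set \<Rightarrow> 'r \<Rightarrow> 'r" where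
  "quotient_action \<phi> C r = the_elem ((\<lambda>g. \<phi> g r) ` C)"

(* Elements of the integral group ring are the finitely supported maps 'g \<Rightarrow>\<^sub>0 int;
   gr g is the basis element g, and the 1 of the group ring is gr \<one>\<^bsub>G\<^esub>.
   Products of group ring elements act by composition, so they are written as iterated gr_act. *)
abbreviation gr :: "'g \<Rightarrow> ('g \<Rightarrow>\<^sub>0 int)" where
  "gr g \<equiv> Poly_Mapping.single g 1"

definition gr_act ::
    "('r, 'k) ring_scheme \<Rightarrow> ('g \<Rightarrow> 'r \<Rightarrow> 'r) \<Rightarrow> ('g \<Rightarrow>\<^sub>0 int) \<Rightarrow> 'r \<Rightarrow> 'r" where
  "gr_act R \<phi> c r =
     (\<Oplus>\<^bsub>R\<^esub>g\<in>Poly_Mapping.keys c. add_pow R (Poly_Mapping.lookup c g) (\<phi> g r))"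

(* Noncommutative polynomials with integer coefficients in variables of type 'v:
   finitely supported integer combinations of words. *)
type_synonym 'v ncpoly = "'v list \<Rightarrow>\<^sub>0 int"

definition ncpoly_vars :: "'v ncpoly \<Rightarrow> 'v set" where
  "ncpoly_vars P = (\<Union>m\<in>Poly_Mapping.keys P. set m)"

definition word_eval :: "('r, 'k) ring_scheme \<Rightarrow> ('v \<Rightarrow> 'r) \<Rightarrow> 'v list \<Rightarrow> 'r" where
  "word_eval R \<rho> m = foldr (\<lambda>v r. \<rho> v \<otimes>\<^bsub>R\<^esub> r) m \<one>\<^bsub>R\<^esub>"

definition ncpoly_eval :: "('r, 'k) ring_scheme \<Rightarrow> ('v \<Rightarrow> 'r) \<Rightarrow> 'v ncpoly \<Rightarrow> 'r" where
  "ncpoly_eval R \<rho> P =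
     (\<Oplus>\<^bsub>R\<^esub>m\<in>Poly_Mapping.keys P. add_pow R (Poly_Mapping.lookup P m) (word_eval R \<rho> m))"

(* A polynomial "in x, the elements of U, b(\<sigma>) and b(\<tau>)" is a polynomial in the
   translates g(x), g(b(\<sigma>)), g(b(\<tau>)) with g \<in> U: the variable (g, s) stands for the
   translate by g of the element named by s. *)
datatype symbol = Norm_one | B_sigma | B_tau

fun symbol_val :: "'r \<Rightarrow> 'r \<Rightarrow> 'r \<Rightarrow> symbol \<Rightarrow> 'r" where
  "symbol_val x bs bt Norm_one = x"
| "symbol_val x bs bt B_sigma = bs"
| "symbol_val x bs bt B_tau = bt"

definition translate_val ::
    "('g \<Rightarrow> 'r \<Rightarrow> 'r) \<Rightarrow> 'r \<Rightarrow> 'r \<Rightarrow> 'r \<Rightarrow> 'g \<times> symbol \<Rightarrow> 'r" where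
  "translate_val \<phi> x bs bt = (\<lambda>(g, s). \<phi> g (symbol_val x bs bt s))"

end

theory Submission
  imports Defs
begin

text \<open>
  The prescribed values \<open>b(\<sigma>\<^sup>2)\<close> and \<open>b(\<tau>)\<close> respect the relations of the dihedral group \<open>U\<close>:
  the norm over the powers of \<open>\<sigma>\<^sup>2\<close> kills \<open>b(\<sigma>\<^sup>2)\<close> because it turns \<open>N_{U_2}(x_2) = 1\<close> into the
  same integer that the subtracted units contribute, and the relation between \<open>\<sigma>\<^sup>2\<close> and \<open>\<tau>\<close>
  follows from \<open>(\<tau> + \<sigma>\<^sup>-\<^sup>1) b(\<sigma>) + (1 - \<sigma>\<^sup>-\<^sup>1) b(\<tau>) = 1\<close>. Hence they extend to a cocycle \<open>b\<close> on \<open>U\<close>,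
  and averaging against the norm one element, \<open>w = - (\<Sum>g\<in>U. b(g) g(x))\<close>, makes it a coboundary.
  This \<open>w\<close> is a polynomial in \<open>U\<close>-translates since \<open>\<sigma>(b(\<sigma>)) = u\<sigma>\<^sup>2\<tau>(b(\<sigma>))\<close>.
\<close>

section \<open>Abelian groups and linear extension\<close>

context abelian_group begin

lemma add_diff_eq: "\<lbrakk>a \<in> carrier G; b \<in> carrier G; c \<in> carrier G\<rbrakk> \<Longrightarrow> a \<oplus> (b \<ominus> c) = a \<oplus> b \<ominus> c"
  by (simp add: minus_eq a_assoc)

lemma diff_add_eq: "\<lbrakk>a \<in> carrier G; b \<in> carrier G; c \<in> carrier G\<rbrakk> \<Longrightarrow> a \<ominus> b \<oplus> c = a \<oplus> c \<ominus> b"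
  by (simp add: minus_eq a_ac)

lemma diff_diff_eq: "\<lbrakk>a \<in> carrier G; b \<in> carrier G; c \<in> carrier G\<rbrakk> \<Longrightarrow> a \<ominus> b \<ominus> c = a \<ominus> (b \<oplus> c)"
  by (simp add: minus_eq a_ac minus_add)

lemma diff_diff_eq2: "\<lbrakk>a \<in> carrier G; b \<in> carrier G; c \<in> carrier G\<rbrakk> \<Longrightarrow> a \<ominus> (b \<ominus> c) = a \<oplus> c \<ominus> b"
  by (simp add: minus_eq a_ac minus_add)

lemma diff_eq_eq: "\<lbrakk>a \<in> carrier G; b \<in> carrier G; c \<in> carrier G\<rbrakk> \<Longrightarrow> a \<ominus> b = c \<longleftrightarrow> a = c \<oplus> b"
  by (auto simp: minus_eq a_assoc l_neg r_neg)

lemma eq_diff_eq: "\<lbrakk>a \<in> carrier G; b \<in> carrier G; c \<in> carrier G\<rbrakk> \<Longrightarrow> a = c \<ominus> b \<longleftrightarrow> a \<oplus> b = c"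
  using diff_eq_eq[of c b a] by auto

text \<open>Moves subtractions outermost and across equations; together with \<open>a_ac\<close>
  this settles identities that merely rearrange signed terms.\<close>

lemmas group_simps = add_diff_eq diff_add_eq diff_diff_eq diff_diff_eq2 diff_eq_eq eq_diff_eq

section \<open>Sums over initial segments: cyclic shift, reflection, splitting\<close>

lemma finsum_lessThan_Suc:
  "(\<And>i. i \<le> n \<Longrightarrow> f i \<in> carrier G) \<Longrightarrow> (\<Oplus>i\<in>{..<Suc n}. f i) = (\<Oplus>i\<in>{..<n}. f i) \<oplus> f n"
  by (subst lessThan_Suc, subst finsum_insert) (auto simp: a_comm intro!: finsum_closed)

lemma finsum_shift:
  fixes f :: "nat \<Rightarrow> 'a"
  assumes "\<And>i. f i \<in> carrier G" "f n = f 0"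
  shows "(\<Oplus>i\<in>{..<n}. f (Suc i)) = (\<Oplus>i\<in>{..<n}. f i)"
proof -
  \<comment> \<open>Both sides are the sum of \<open>f\<close> over 0, ..., k, which allows
    induction without periodicity; for \<open>k = n\<close> the equal end terms cancel.\<close>
  have "(\<Oplus>i\<in>{..<k}. f (Suc i)) \<oplus> f 0 = (\<Oplus>i\<in>{..<k}. f i) \<oplus> f k" for k
  proof (induction k)
    case (Suc k)
    have cl: "(\<Oplus>i\<in>{..<k}. f (Suc i)) \<in> carrier G"
      using assms(1) by (auto intro!: finsum_closed)
    have "(\<Oplus>i\<in>{..<Suc k}. f (Suc i)) \<oplus> f 0 = ((\<Oplus>i\<in>{..<k}. f (Suc i)) \<oplus> f 0) \<oplus> f (Suc k)"
      using assms(1) cl by (simp add: finsum_lessThan_Suc a_ac)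
    then show ?case
      using Suc assms(1) by (simp add: finsum_lessThan_Suc)
  qed (simp add: assms)
  from this[of n] show ?thesis
    using assms by (simp add: Pi_def)
qed

lemma finsum_shift_by:
  fixes f :: "nat \<Rightarrow> 'a"
  assumes "\<And>i. f i \<in> carrier G" "\<And>i. f (i + n) = f i"
  shows "(\<Oplus>i\<in>{..<n}. f (i + c)) = (\<Oplus>i\<in>{..<n}. f i)"
proof (induction c)
  case (Suc c)
  have "(\<Oplus>i\<in>{..<n}. f (Suc i + c)) = (\<Oplus>i\<in>{..<n}. f (i + c))"
    using assms(2)[of c] by (intro finsum_shift) (auto simp: assms(1) add.commute)
  then show ?case using Suc by simp
qed simp

text \<open>For \<open>i < n\<close> the argument \<open>n - i\<close> runs through 1, ..., n.
  Reindexing by \<open>n - Suc i\<close> makes this a shifted sum, and \<open>f n = f 0\<close>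
  closes the cycle.\<close>

lemma finsum_reflect:
  fixes f :: "nat \<Rightarrow> 'a"
  assumes "\<And>i. f i \<in> carrier G" "f n = f 0"
  shows "(\<Oplus>i\<in>{..<n}. f (n - i)) = (\<Oplus>i\<in>{..<n}. f i)"
proof -
  have "(\<Oplus>i\<in>{..<n}. f (n - i)) = (\<Oplus>i\<in>(\<lambda>i. n - Suc i) ` {..<n}. f (Suc i))"
    using assms(1) by (subst finsum_reindex) (auto simp: inj_on_def Suc_diff_Suc intro!: finsum_cong)
  also have "(\<lambda>i. n - Suc i) ` {..<n} = {..<n}"
  proof
    show "{..<n} \<subseteq> (\<lambda>i. n - Suc i) ` {..<n}"
    proof
      fix i assume "i \<in> {..<n}"
      then show "i \<in> (\<lambda>i. n - Suc i) ` {..<n}"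
        by (intro image_eqI[of _ _ "n - Suc i"]) auto
    qed
  qed auto
  finally show ?thesis
    using finsum_shift[OF assms] by simp
qed

lemma finsum_even_odd:
  fixes f :: "nat \<Rightarrow> 'a"
  assumes "\<And>i. f i \<in> carrier G"
  shows "(\<Oplus>i\<in>{..<2*n}. f i) = (\<Oplus>i\<in>{..<n}. f (2*i) \<oplus> f (Suc (2*i)))"
proof (induction n)
  case (Suc n)
  then show ?case using assms
    by (simp add: finsum_lessThan_Suc a_assoc del: finsum_addf)
qed simp

lemma finsum_halves:
  fixes f :: "nat \<Rightarrow> 'a"
  assumes "\<And>i. f i \<in> carrier G"
  shows "(\<Oplus>i\<in>{..<m+n}. f i) = (\<Oplus>i\<in>{..<m}. f i) \<oplus> (\<Oplus>i\<in>{..<n}. f (i + m))"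
proof (induction n)
  case 0
  then show ?case using assms by (simp add: Pi_def)
next
  case (Suc n)
  then show ?case using assms by (simp add: finsum_lessThan_Suc a_assoc add.commute)
qed

end

text \<open>Common form of \<open>gr_act\<close> (extension of g \<mapsto> g(r) from group elements)
  and \<open>ncpoly_eval\<close> (extension of \<open>word_eval\<close> from words), so that
  additivity is proved once for both.\<close>

definition lin_ext :: "('r, 'k) ring_scheme \<Rightarrow> ('v \<Rightarrow> 'r) \<Rightarrow> ('v \<Rightarrow>\<^sub>0 int) \<Rightarrow> 'r" where
  "lin_ext R f c = (\<Oplus>\<^bsub>R\<^esub>v\<in>Poly_Mapping.keys c. add_pow R (Poly_Mapping.lookup c v) (f v))"

context ring begin

lemma add_pow_int_zero [simp]: "add_pow R (0::int) a = \<zero>"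
  by (simp add: add_pow_def)

text \<open>Outside the support the coefficients are zero, so a larger index set adds only zeros;
  combinations with different supports become comparable.\<close>

lemma lin_ext_superset:
  assumes "finite A" "Poly_Mapping.keys c \<subseteq> A" "\<And>v. v \<in> A \<Longrightarrow> f v \<in> carrier R"
  shows "lin_ext R f c = (\<Oplus>v\<in>A. add_pow R (Poly_Mapping.lookup c v) (f v))"
  unfolding lin_ext_def
  by (rule add.finprod_mono_neutral_cong_left) (use assms in \<open>auto simp: in_keys_iff\<close>)

lemma lin_ext_closed [simp]:
  "(\<And>v. v \<in> Poly_Mapping.keys c \<Longrightarrow> f v \<in> carrier R) \<Longrightarrow> lin_ext R f c \<in> carrier R"
  unfolding lin_ext_def by (auto intro!: finsum_closed)

lemma lin_ext_zero [simp]: "lin_ext R f 0 = \<zero>"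
  by (simp add: lin_ext_def)

lemma lin_ext_single: "f v \<in> carrier R \<Longrightarrow> lin_ext R f (Poly_Mapping.single v 1) = f v"
  by (simp add: lin_ext_def)

lemma lin_ext_add:
  assumes "\<And>v. v \<in> Poly_Mapping.keys c \<union> Poly_Mapping.keys d \<Longrightarrow> f v \<in> carrier R"
  shows "lin_ext R f (c + d) = lin_ext R f c \<oplus> lin_ext R f d"
proof -
  \<comment> \<open>Cancellation can make the support of \<open>c + d\<close> smaller than this
    union, so all three sums are taken over the union.\<close>
  let ?A = "Poly_Mapping.keys c \<union> Poly_Mapping.keys d"
  have "Poly_Mapping.keys (c + d) \<subseteq> ?A" by (rule Poly_Mapping.keys_add)
  then have "lin_ext R f (c + d) = (\<Oplus>v\<in>?A. add_pow R (Poly_Mapping.lookup (c + d) v) (f v))"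
    using assms by (intro lin_ext_superset) auto
  also have "\<dots> = (\<Oplus>v\<in>?A. add_pow R (Poly_Mapping.lookup c v) (f v)
      \<oplus> add_pow R (Poly_Mapping.lookup d v) (f v))"
    using assms by (intro finsum_cong') (auto simp: lookup_add add.int_pow_mult)
  also have "\<dots> = (\<Oplus>v\<in>?A. add_pow R (Poly_Mapping.lookup c v) (f v))
      \<oplus> (\<Oplus>v\<in>?A. add_pow R (Poly_Mapping.lookup d v) (f v))"
    using assms by (intro finsum_addf) auto
  also have "(\<Oplus>v\<in>?A. add_pow R (Poly_Mapping.lookup c v) (f v)) = lin_ext R f c"
    using assms by (intro lin_ext_superset[symmetric]) auto
  also have "(\<Oplus>v\<in>?A. add_pow R (Poly_Mapping.lookup d v) (f v)) = lin_ext R f d"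
    using assms by (intro lin_ext_superset[symmetric]) auto
  finally show ?thesis .
qed

lemma lin_ext_diff:
  assumes "\<And>v. v \<in> Poly_Mapping.keys c \<union> Poly_Mapping.keys d \<Longrightarrow> f v \<in> carrier R"
  shows "lin_ext R f (c - d) = lin_ext R f c \<ominus> lin_ext R f d"
proof -
  have *: "Poly_Mapping.keys (c - d) \<subseteq> Poly_Mapping.keys c \<union> Poly_Mapping.keys d"
    by (rule keys_diff)
  \<comment> \<open>Additivity is applied to \<open>(c - d) + d\<close>.\<close>
  have "lin_ext R f c = lin_ext R f (c - d) \<oplus> lin_ext R f d"
    using lin_ext_add[of "c - d" d f] assms * by auto
  moreover have "lin_ext R f (c - d) \<in> carrier R"
    using * assms by (blast intro: lin_ext_closed)
  ultimately show ?thesis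
    using assms by (simp add: eq_diff_eq)
qed

lemma lin_ext_uminus:
  "(\<And>v. v \<in> Poly_Mapping.keys c \<Longrightarrow> f v \<in> carrier R) \<Longrightarrow> lin_ext R f (- c) = \<ominus> lin_ext R f c"
  using lin_ext_diff[of 0 c f] by (simp add: minus_eq)

lemma lin_ext_sum:
  assumes "finite I" "\<And>i v. i \<in> I \<Longrightarrow> v \<in> Poly_Mapping.keys (c i) \<Longrightarrow> f v \<in> carrier R"
  shows "lin_ext R f (\<Sum>i\<in>I. c i) = (\<Oplus>i\<in>I. lin_ext R f (c i))"
  using assms
proof (induction I rule: finite_induct)
  case (insert i I)
  have "Poly_Mapping.keys (sum c I) \<subseteq> (\<Union>i\<in>I. Poly_Mapping.keys (c i))"
    by (rule Poly_Mapping.keys_sum)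
  then have "lin_ext R f (c i + sum c I) = lin_ext R f (c i) \<oplus> lin_ext R f (sum c I)"
    using insert by (intro lin_ext_add) auto
  also have "lin_ext R f (sum c I) = (\<Oplus>i\<in>I. lin_ext R f (c i))"
    using insert by auto
  also have "lin_ext R f (c i) \<oplus> (\<Oplus>i\<in>I. lin_ext R f (c i)) = (\<Oplus>i\<in>insert i I. lin_ext R f (c i))"
    using insert by (intro finsum_insert[symmetric]) (auto intro!: lin_ext_closed)
  finally show ?case
    using insert by simp
qed simp

end

section \<open>The cocycle and its splitting\<close>

text \<open>\<open>S k\<close> models the action of \<sigma>^k and \<open>T\<close> that of \<tau>.
  With m = 2^(n-1) the exponent 2m is a period and \<open>S (int m)\<close> is the action of u.
  Integer exponents give direct access to inverses.\<close>

locale dihedral_ring_action = ring R for R (structure) +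
  fixes S :: "int \<Rightarrow> 'a \<Rightarrow> 'a" and T :: "'a \<Rightarrow> 'a" and m :: nat
  assumes S_hom: "S k \<in> ring_hom R R"
    and T_hom: "T \<in> ring_hom R R"
    and S_S: "r \<in> carrier R \<Longrightarrow> S i (S j r) = S (i + j) r"
    and S_order: "r \<in> carrier R \<Longrightarrow> S (2 * int m) r = r"
    and T_S: "r \<in> carrier R \<Longrightarrow> T (S k r) = S (- k) (T r)"
    and T_T [simp]: "r \<in> carrier R \<Longrightarrow> T (T r) = r"
begin

lemma S_closed [simp]: "r \<in> carrier R \<Longrightarrow> S k r \<in> carrier R"
  by (rule ring_hom_closed[OF S_hom])

lemma T_closed [simp]: "r \<in> carrier R \<Longrightarrow> T r \<in> carrier R"
  by (rule ring_hom_closed[OF T_hom])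

lemma S_mult [simp]: "r \<in> carrier R \<Longrightarrow> s \<in> carrier R \<Longrightarrow> S k (r \<otimes> s) = S k r \<otimes> S k s"
  by (rule ring_hom_mult[OF S_hom])

lemma T_mult [simp]: "r \<in> carrier R \<Longrightarrow> s \<in> carrier R \<Longrightarrow> T (r \<otimes> s) = T r \<otimes> T s"
  by (rule ring_hom_mult[OF T_hom])

lemma S_add [simp]: "r \<in> carrier R \<Longrightarrow> s \<in> carrier R \<Longrightarrow> S k (r \<oplus> s) = S k r \<oplus> S k s"
  by (rule ring_hom_add[OF S_hom])

lemma T_add [simp]: "r \<in> carrier R \<Longrightarrow> s \<in> carrier R \<Longrightarrow> T (r \<oplus> s) = T r \<oplus> T s"
  by (rule ring_hom_add[OF T_hom])

lemma S_one [simp]: "S k \<one> = \<one>"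
  by (rule ring_hom_one[OF S_hom])

lemma T_one [simp]: "T \<one> = \<one>"
  by (rule ring_hom_one[OF T_hom])

lemma S_zero [simp]: "S k \<zero> = \<zero>"
  by (rule ring_hom_zero[OF S_hom ring_axioms ring_axioms])

lemma S_uminus [simp]: "r \<in> carrier R \<Longrightarrow> S k (\<ominus> r) = \<ominus> S k r"
  using S_add[of "\<ominus> r" r k] by (simp add: l_neg minus_equality)

lemma S_diff [simp]: "r \<in> carrier R \<Longrightarrow> s \<in> carrier R \<Longrightarrow> S k (r \<ominus> s) = S k r \<ominus> S k s"
  by (simp add: minus_eq)

lemma T_zero [simp]: "T \<zero> = \<zero>"
  by (rule ring_hom_zero[OF T_hom ring_axioms ring_axioms])

lemma T_uminus [simp]: "r \<in> carrier R \<Longrightarrow> T (\<ominus> r) = \<ominus> T r"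
  using T_add[of "\<ominus> r" r] by (simp add: l_neg minus_equality)

lemma T_diff [simp]: "r \<in> carrier R \<Longrightarrow> s \<in> carrier R \<Longrightarrow> T (r \<ominus> s) = T r \<ominus> T s"
  by (simp add: minus_eq)

lemma S_0 [simp]: "r \<in> carrier R \<Longrightarrow> S 0 r = r"
  using S_S[of r 0 "2 * int m"] by (simp add: S_order)

lemma S_period: "r \<in> carrier R \<Longrightarrow> S (k + 2 * int m) r = S k r"
  using S_S[of r k "2 * int m"] by (simp add: S_order)

lemma S_finsum:
  fixes n :: nat
  assumes "\<And>i. f i \<in> carrier R"
  shows "S k (\<Oplus>i\<in>{..<n}. f i) = (\<Oplus>i\<in>{..<n}. S k (f i))"
  by (induction n) (use assms in \<open>simp_all add: finsum_lessThan_Suc Pi_iff\<close>)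

lemma T_finsum:
  fixes n :: nat
  assumes "\<And>i. f i \<in> carrier R"
  shows "T (\<Oplus>i\<in>{..<n}. f i) = (\<Oplus>i\<in>{..<n}. T (f i))"
  by (induction n) (use assms in \<open>simp_all add: finsum_lessThan_Suc Pi_iff\<close>)

text \<open>This is N_U: the elements of U are \<sigma>^(2i) and \<sigma>^(2i)\<tau> for i <
  m.\<close>

definition norm_half :: "'a \<Rightarrow> 'a" where
  "norm_half r = (\<Oplus>i\<in>{..<m}. S (2 * int i) r \<oplus> S (2 * int i) (T r))"

lemma norm_half_closed [simp]: "r \<in> carrier R \<Longrightarrow> norm_half r \<in> carrier R"
  unfolding norm_half_def by (intro finsum_closed) auto

end

text \<open>\<open>z\<close> is the element x_2, and \<open>norm_z\<close> spells out its norm over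
  U_2 = {1, u, \<sigma>\<tau>, u\<sigma>\<tau>}.\<close>

locale dihedral_norm_one = dihedral_ring_action +
  fixes x z :: 'a
  assumes x_closed [simp]: "x \<in> carrier R"
    and z_closed [simp]: "z \<in> carrier R"
    and norm_x: "norm_half x = \<one>"
    and norm_z: "z \<oplus> S (int m) z \<oplus> (S 1 (T z) \<oplus> S (int m + 1) (T z)) = \<one>"
begin

text \<open>\<open>bs\<close>, \<open>bt\<close> and \<open>bss\<close> are b(\<sigma>), b(\<tau>)
  and b(\<sigma>^2).\<close>

definition "bs = S 1 z \<oplus> S (int m) (T z)"
definition "bt = T (z \<oplus> S (int m) z) \<ominus> (z \<oplus> S (int m) z)"
definition "bss = bs \<oplus> S 1 bs \<ominus> \<one>"

lemma b_closed [simp]: "bs \<in> carrier R" "bt \<in> carrier R" "bss \<in> carrier R"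
  by (simp_all add: bs_def bt_def bss_def)

section \<open>Relations between the prescribed values\<close>

lemma relation:
  "S k z \<oplus> S (k + int m) z \<oplus> (S (k + 1) (T z) \<oplus> S (k + int m + 1) (T z)) = \<one>"
  using arg_cong[OF norm_z, of "S k"] by (simp add: S_S add.assoc)

text \<open>The element u is an involution: the exponents -m and m differ by the period.\<close>

lemma S_neg_m: "r \<in> carrier R \<Longrightarrow> S (k - int m) r = S (k + int m) r"
  using S_period[of r "k - int m"] by (simp add: algebra_simps)

lemma bt_eq: "bt = T z \<oplus> S (int m) (T z) \<ominus> (z \<oplus> S (int m) z)"
  using S_neg_m[of "T z" 0] by (simp add: bt_def T_S)

text \<open>Cocycle condition for \<tau>^2 = 1; it holds because \<open>bt\<close> is an image of
  \<tau> - 1 and \<tau>(\<tau> - 1) = -(\<tau> - 1).\<close>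

lemma T_bt: "T bt = \<ominus> bt"
  unfolding bt_def by (simp add: minus_eq minus_add a_ac)

text \<open>The element u\<sigma>^2\<tau> sends the summands \<sigma>(x_2) and u\<tau>(x_2) of
  \<open>bs\<close> to u\<sigma>\<tau>(x_2) and \<sigma>^2(x_2), the same two elements that \<sigma>
  produces in the other order. This is what allows a translate by \<sigma> to be written as a
  translate by U.\<close>

lemma S_1_bs: "S 1 bs = S (int m + 2) (T bs)"
  using S_neg_m[of z 2] by (simp add: bs_def S_S T_S a_comm add.commute)

lemma T_bs: "T bs \<oplus> S (- 1) bs \<oplus> bt = \<one> \<oplus> S (- 1) bt"
proof -
  have "T bs \<oplus> S (- 1) bs \<oplus> bt = S (-1) (T z) \<oplus> S (int m) z \<oplus> (z \<oplus> S (int m - 1) (T z)) \<oplus> bt"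
    using S_neg_m[of z 0] by (simp add: bs_def S_S T_S)
  \<comment> \<open>Adding \<open>bt\<close> trades \<open>z\<close> and u(\<open>z\<close>) for
    \<tau>(\<open>z\<close>) and u\<tau>(\<open>z\<close>).\<close>
  also have "\<dots> = S (-1) (T z) \<oplus> S (int m - 1) (T z) \<oplus> T z \<oplus> S (int m) (T z)"
    by (simp add: bt_eq group_simps a_ac)
  \<comment> \<open>The \<sigma>^(-1)-translate of the norm relation contains exactly
    \<tau>(\<open>z\<close>) and u\<tau>(\<open>z\<close>); its remaining terms combine with the
    others to form the translate of \<open>bt\<close>.\<close>
  also have "\<dots> = \<one> \<oplus> S (- 1) bt"
    unfolding relation[of "-1", symmetric] by (simp add: bt_eq group_simps S_S a_ac)
  finally show ?thesis .
qed

text \<open>Cocycle condition for (\<sigma>^2\<tau>)^2 = 1, after replacing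
  \<tau>(\<open>bt\<close>) by -\<open>bt\<close>. Since \<open>bss\<close> is built from
  \<open>bs\<close> and \<sigma>(\<open>bs\<close>), it is the sum of the translates of
  \<open>T_bs\<close> by \<sigma> and \<sigma>^2, in which \<open>S 1 bt\<close> cancels.\<close>

lemma third_relation: "bss \<oplus> S 2 bt \<oplus> S 2 (T bss) = bt"
proof -
  have "S 1 (T bs) \<oplus> bs \<oplus> S 1 bt = \<one> \<oplus> bt"
    using arg_cong[OF T_bs, of "S 1"] by (simp add: S_S)
  moreover have "S 2 (T bs) \<oplus> S 1 bs \<oplus> S 2 bt = \<one> \<oplus> S 1 bt"
    using arg_cong[OF T_bs, of "S 2"] by (simp add: S_S)
  ultimately have "(S 1 (T bs) \<oplus> bs \<oplus> S 1 bt) \<oplus> (S 2 (T bs) \<oplus> S 1 bs \<oplus> S 2 bt)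
      = (\<one> \<oplus> bt) \<oplus> (\<one> \<oplus> S 1 bt)"
    by simp
  then have "S 1 bt \<oplus> (S 1 (T bs) \<oplus> bs \<oplus> S 2 (T bs) \<oplus> S 1 bs \<oplus> S 2 bt) = S 1 bt \<oplus> (bt \<oplus> \<one> \<oplus> \<one>)"
    by (simp add: a_ac)
  then have "S 1 (T bs) \<oplus> bs \<oplus> S 2 (T bs) \<oplus> S 1 bs \<oplus> S 2 bt = bt \<oplus> \<one> \<oplus> \<one>"
    by (subst (asm) add.l_cancel) auto
  then show ?thesis
    by (simp add: bss_def T_S S_S group_simps a_ac)
qed

text \<open>\<open>B i\<close> is the value at \<open>\<sigma>\<^sup>2\<^sup>i\<close> of the cocycle on \<open>U\<close> with the prescribed values at
  \<open>\<sigma>\<^sup>2\<close> and \<open>\<tau>\<close>. \<open>B_m\<close> and \<open>T_B\<close> say that the relations of \<open>U\<close> are respected.\<close>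

definition B :: "nat \<Rightarrow> 'a" where
  "B i = (\<Oplus>j\<in>{..<i}. S (2 * int j) bss)"

lemma B_closed [simp]: "B i \<in> carrier R"
  unfolding B_def by (intro finsum_closed) auto

lemma B_Suc: "B (Suc i) = B i \<oplus> S (2 * int i) bss"
  unfolding B_def by (simp add: finsum_lessThan_Suc)

lemma B_0 [simp]: "B 0 = \<zero>"
  by (simp add: B_def)

text \<open>The cocycle rule for the product of \<sigma>^2 and \<sigma>^(2i), solved for the
  translated value.\<close>

lemma S_B: "S 2 (B i) = B (Suc i) \<ominus> bss"
proof (induction i)
  case (Suc i)
  have "S 2 (B (Suc i)) = S 2 (B i) \<oplus> S (2 * int (Suc i)) bss"
    by (simp add: B_Suc S_S)
  also have "\<dots> = B (Suc (Suc i)) \<ominus> bss"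
    unfolding Suc by (subst B_Suc) (simp add: group_simps)
  finally show ?case .
qed (simp add: B_Suc group_simps)

text \<open>Cocycle condition for (\<sigma>^2)^m = 1. Both sides of the comparison below amount to m
  copies of the unit.\<close>

lemma B_m: "B m = \<zero>"
proof -
  have S_nat: "S (int (i + 2 * m) + k) r = S (int i + k) r" if "r \<in> carrier R" for i k r
    using S_period[of r "int i + k"] that by (simp add: algebra_simps)
  \<comment> \<open>One unit per summand cancels the -1 inside \<open>bss\<close>; what remains are
    \<open>bs\<close> and \<sigma>(\<open>bs\<close>) at even exponents, hence all 2m translates of
    \<open>bs\<close>.\<close>
  have "B m \<oplus> (\<Oplus>i\<in>{..<m}. \<one>) = (\<Oplus>i\<in>{..<m}. S (2 * int i) bss \<oplus> \<one>)"
    unfolding B_def by (intro finsum_addf[symmetric]) auto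
  also have "\<dots> = (\<Oplus>i\<in>{..<m}. S (int (2 * i)) bs \<oplus> S (int (Suc (2 * i))) bs)"
    by (intro finsum_cong') (auto simp: bss_def S_S group_simps add.commute)
  also have "\<dots> = (\<Oplus>k\<in>{..<2 * m}. S (int k) bs)"
    by (intro finsum_even_odd[symmetric]) auto
  also have "\<dots> = (\<Oplus>k\<in>{..<2 * m}. S (int (k + 1)) z \<oplus> S (int (k + m)) (T z))"
    by (intro finsum_cong') (auto simp: bs_def S_S add.commute)
  also have "\<dots> = (\<Oplus>k\<in>{..<2 * m}. S (int (k + 1)) z) \<oplus> (\<Oplus>k\<in>{..<2 * m}. S (int (k + m)) (T z))"
    by (intro finsum_addf) auto
  also have "(\<Oplus>k\<in>{..<2 * m}. S (int (k + 1)) z) = (\<Oplus>k\<in>{..<2 * m}. S (int k) z)"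
    using S_nat[of z _ 0] by (intro finsum_shift_by) auto
  also have "(\<Oplus>k\<in>{..<2 * m}. S (int (k + m)) (T z)) = (\<Oplus>k\<in>{..<2 * m}. S (int k) (T z))"
    using S_nat[of "T z" _ 0] by (intro finsum_shift_by) auto
  \<comment> \<open>The offset 1 is chosen so that the terms at k and k + m together form the
    \<sigma>^k-translate of N_{U_2}(x_2), which is 1.\<close>
  also have "\<dots> = (\<Oplus>k\<in>{..<2 * m}. S (int (k + 1)) (T z))"
    using S_nat[of "T z" _ 0] by (intro finsum_shift_by[symmetric]) auto
  also have "(\<Oplus>k\<in>{..<2 * m}. S (int k) z) \<oplus> (\<Oplus>k\<in>{..<2 * m}. S (int (k + 1)) (T z))
      = (\<Oplus>k\<in>{..<2 * m}. S (int k) z \<oplus> S (int (k + 1)) (T z))"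
    by (intro finsum_addf[symmetric]) auto
  also have "\<dots> = (\<Oplus>k\<in>{..<m}. S (int k) z \<oplus> S (int (k + 1)) (T z))
      \<oplus> (\<Oplus>k\<in>{..<m}. S (int (k + m)) z \<oplus> S (int (k + m + 1)) (T z))"
    unfolding mult_2 by (intro finsum_halves) auto
  also have "\<dots> = (\<Oplus>k\<in>{..<m}. S (int k) z \<oplus> S (int (k + 1)) (T z)
      \<oplus> (S (int (k + m)) z \<oplus> S (int (k + m + 1)) (T z)))"
    by (intro finsum_addf[symmetric]) auto
  also have "\<dots> = (\<Oplus>k\<in>{..<m}. \<one>)"
  proof (intro finsum_cong')
    fix k
    show "S (int k) z \<oplus> S (int (k + 1)) (T z) \<oplus> (S (int (k + m)) z \<oplus> S (int (k + m + 1)) (T z)) = \<one>"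
      unfolding relation[of "int k", symmetric] by (simp add: a_ac add_ac)
  qed auto
  finally have "B m = (\<Oplus>i\<in>{..<m}. \<one>) \<ominus> (\<Oplus>i\<in>{..<m}. \<one>)"
    by (subst eq_diff_eq) (auto intro!: finsum_closed)
  then show ?thesis
    by (simp add: minus_eq r_neg)
qed

text \<open>The two ways of writing \<tau>\<sigma>^(2i) = \<sigma>^(2(m-i))\<tau> must give the same
  cocycle value; using \<open>m - i\<close> instead of \<open>- i\<close> keeps the index natural.
  The case \<open>i = 0\<close> is \<open>B_m\<close>.\<close>

lemma T_B: "i \<le> m \<Longrightarrow> T (B i) = B (m - i) \<oplus> S (2 * (int m - int i)) bt \<ominus> bt"
proof (induction i)
  case 0
  then show ?case by (simp add: B_m S_order minus_eq r_neg)
next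
  case (Suc i)
  \<comment> \<open>\<open>j\<close> is the reflected index and \<open>k\<close> = 2j its exponent,
    so that 2m - 2i = k + 2.\<close>
  define j where "j = m - Suc i"
  define k where "k = 2 * (int m - int (Suc i))"
  have j: "m - i = Suc j" "2 * int j = k" and k: "2 * int m - 2 * int i = k + 2"
    using Suc.prems by (auto simp: j_def k_def)
  have neg: "S (- (2 * int i)) r = S (k + 2) r" if "r \<in> carrier R" for r
    using S_period[OF that, of "- (2 * int i)"] by (simp add: k_def algebra_simps)
  \<comment> \<open>Passing from \<open>m - i\<close> to \<open>m - Suc i\<close> removes one term
    \<open>S k bss\<close>; this translate of \<open>third_relation\<close> accounts for it.\<close>
  have rel: "S k bss \<oplus> S (k + 2) bt \<oplus> S (k + 2) (T bss) = S k bt"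
    using arg_cong[OF third_relation, of "S k"] by (simp add: S_S)
  have "T (B (Suc i)) = B (Suc j) \<oplus> S (k + 2) bt \<ominus> bt \<oplus> S (k + 2) (T bss)"
    using Suc by (simp add: B_Suc[of i] T_S neg j k)
  also have "\<dots> = B j \<oplus> (S k bss \<oplus> S (k + 2) bt \<oplus> S (k + 2) (T bss)) \<ominus> bt"
    by (simp add: B_Suc j group_simps a_ac)
  finally show ?case
    unfolding rel by (simp add: j_def k_def)
qed

section \<open>Averaging the cocycle against the norm one element\<close>

definition K :: "nat \<Rightarrow> 'a" where
  "K i = S (2 * int i) x \<oplus> S (2 * int i) (T x)"

text \<open>The two terms b(g)g(x) for g = \<sigma>^(2i) and g = \<sigma>^(2i)\<tau>; the second
  coefficient comes from the cocycle rule.\<close>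

definition F :: "nat \<Rightarrow> 'a" where
  "F i = B i \<otimes> S (2 * int i) x \<oplus> (B i \<oplus> S (2 * int i) bt) \<otimes> S (2 * int i) (T x)"

lemma K_closed [simp]: "K i \<in> carrier R"
  by (simp add: K_def)

lemma F_closed [simp]: "F i \<in> carrier R"
  by (simp add: F_def)

lemma K_m: "K m = K 0"
  by (simp add: K_def S_order)

text \<open>Closes the index range to a cycle of length m, as \<open>finsum_shift\<close> and
  \<open>finsum_reflect\<close> require.\<close>

lemma F_m: "F m = F 0"
  by (simp add: F_def S_order B_m)

lemma sum_K: "(\<Oplus>i\<in>{..<m}. K i) = \<one>"
  using norm_x by (simp add: K_def norm_half_def)

definition w :: 'a where
  "w = \<ominus> (\<Oplus>i\<in>{..<m}. F i)"

lemma sum_F_closed [simp]: "(\<Oplus>i\<in>{..<m}. F i) \<in> carrier R"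
  by (intro finsum_closed) auto

lemma w_closed [simp]: "w \<in> carrier R"
  by (simp add: w_def)

text \<open>Translation by \<sigma>^2 permutes the terms b(g)g(x) up to corrections
  b(\<sigma>^2)g(x), which sum to b(\<sigma>^2)N_U(x) = b(\<sigma>^2). The minus sign in
  \<open>w\<close> turns the resulting deficit into a surplus.\<close>

lemma S_w: "S 2 w = w \<oplus> bss"
proof -
  have step: "S 2 (F i) \<oplus> bss \<otimes> K (Suc i) = F (Suc i)" for i
    by (simp add: F_def K_def S_B S_S minus_eq l_distr r_distr l_minus a_ac r_neg r_neg1 r_neg2)
  have "S 2 (\<Oplus>i\<in>{..<m}. F i) \<oplus> bss \<otimes> (\<Oplus>i\<in>{..<m}. K (Suc i)) = (\<Oplus>i\<in>{..<m}. F (Suc i))"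
    by (simp add: S_finsum finsum_rdistr finsum_addf[symmetric] step)
  then have "S 2 (\<Oplus>i\<in>{..<m}. F i) \<oplus> bss = (\<Oplus>i\<in>{..<m}. F i)"
    using finsum_shift[of F m] finsum_shift[of K m] by (simp add: F_m K_m sum_K)
  then have "S 2 (\<Oplus>i\<in>{..<m}. F i) = (\<Oplus>i\<in>{..<m}. F i) \<ominus> bss"
    by (subst eq_diff_eq) auto
  then show ?thesis
    by (simp add: w_def minus_eq minus_add)
qed

text \<open>The same argument for \<tau>, which exchanges rotations with reflections and reverses
  the index from i to m - i; hence reflected sums replace shifted ones.\<close>

lemma T_w: "T w = w \<oplus> bt"
proof -
  have step: "T (F i) \<oplus> bt \<otimes> K (m - i) = F (m - i)" if "i \<in> {..<m}" for i
  proof -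
    have neg: "S (- (2 * int i)) r = S (2 * (int m - int i)) r" if "r \<in> carrier R" for r
      using S_period[OF that, of "- (2 * int i)"] by (simp add: algebra_simps)
    show ?thesis
      using that
      by (simp add: F_def K_def T_B T_S T_bt neg of_nat_diff minus_eq l_distr r_distr l_minus a_ac
          r_neg r_neg1 r_neg2)
  qed
  have "T (\<Oplus>i\<in>{..<m}. F i) \<oplus> bt \<otimes> (\<Oplus>i\<in>{..<m}. K (m - i)) = (\<Oplus>i\<in>{..<m}. T (F i) \<oplus> bt \<otimes> K (m - i))"
    by (simp add: T_finsum finsum_rdistr)
  also have "\<dots> = (\<Oplus>i\<in>{..<m}. F (m - i))"
    by (intro finsum_cong') (auto simp: step)
  finally have "T (\<Oplus>i\<in>{..<m}. F i) \<oplus> bt = (\<Oplus>i\<in>{..<m}. F i)"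
    using finsum_reflect[of F m] finsum_reflect[of K m] by (simp add: F_m K_m sum_K)
  then have "T (\<Oplus>i\<in>{..<m}. F i) = (\<Oplus>i\<in>{..<m}. F i) \<ominus> bt"
    by (subst eq_diff_eq) auto
  then show ?thesis
    by (simp add: w_def minus_eq minus_add)
qed

section \<open>The invariant element and its norms\<close>

definition "a = bs \<oplus> (w \<ominus> S 1 w)"

lemma a_closed [simp]: "a \<in> carrier R"
  by (simp add: a_def)

text \<open>Since (1 + \<sigma>)(1 - \<sigma>) = 1 - \<sigma>^2, the part from \<open>w\<close>
  contributes -\<open>bss\<close>, which cancels (1 + \<sigma>)(\<open>bs\<close>) up to 1.\<close>

lemma trace_a: "a \<oplus> S 1 a = \<one>"
  by (simp add: a_def S_S S_w bss_def group_simps a_ac)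

lemma S_1_a: "S 1 a = \<one> \<ominus> a"
  using trace_a by (simp add: eq_diff_eq a_comm)

text \<open>Applying \<sigma> to \<sigma>(a) = 1 - a returns 1 - (1 - a).\<close>

lemma S_2_a: "S 2 a = a"
  using S_S[of a 1 1] by (simp add: S_1_a group_simps a_comm)

lemma T_a: "T a = a"
proof -
  have S_1_w: "S 1 w = S (- 1) w \<oplus> S (- 1) bss"
    using arg_cong[OF S_w, of "S (- 1)"] by (simp add: S_S)
  \<comment> \<open>The extra term \<sigma>^(-1)(\<open>bs\<close>) completes the left side of
    \<open>T_bs\<close>; on the other side it is absorbed by the translate of \<open>bss\<close>
    coming from \<open>S_1_w\<close>.\<close>
  have "T a \<oplus> S (- 1) bs = (T bs \<oplus> S (- 1) bs \<oplus> bt) \<oplus> w \<ominus> S (- 1) w \<ominus> S (- 1) bt"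
    by (simp add: a_def T_S T_w group_simps a_ac)
  also have "\<dots> = \<one> \<oplus> w \<ominus> S (- 1) w"
    unfolding T_bs by (simp add: group_simps a_ac)
  also have "\<dots> = a \<oplus> S (- 1) bs"
    by (simp add: a_def S_1_w bss_def S_S group_simps a_ac)
  finally show ?thesis
    by (subst (asm) add.r_cancel) auto
qed

lemma S_even_a: "S (2 * int i) a = a"
proof (induction i)
  case (Suc i)
  then show ?case
    using S_S[of a 2 "2 * int i"] by (simp add: S_2_a)
qed simp

text \<open>The factor \<open>a\<close> is fixed by U, so it comes out of N_U on the left and leaves
  N_U(x) = 1.\<close>

lemma norm_half_a: "norm_half (a \<otimes> x) = a"
proof -
  have "norm_half (a \<otimes> x) = (\<Oplus>i\<in>{..<m}. a \<otimes> K i)"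
    unfolding norm_half_def by (intro finsum_cong') (auto simp: T_a S_even_a K_def r_distr)
  also have "\<dots> = a \<otimes> (\<Oplus>i\<in>{..<m}. K i)"
    by (intro finsum_rdistr[symmetric]) auto
  finally show ?thesis by (simp add: sum_K)
qed

text \<open>Transitivity of the norm: even exponents give the elements of U, odd ones the coset
  \<sigma>U.\<close>

lemma norm_full:
  assumes r: "r \<in> carrier R"
  shows "(\<Oplus>k\<in>{..<2 * m}. S (int k) r \<oplus> S (int k) (T r)) = norm_half r \<oplus> S 1 (norm_half r)"
proof -
  have "(\<Oplus>k\<in>{..<2 * m}. S (int k) r \<oplus> S (int k) (T r))
      = (\<Oplus>i\<in>{..<m}. (S (2 * int i) r \<oplus> S (2 * int i) (T r))
          \<oplus> S 1 (S (2 * int i) r \<oplus> S (2 * int i) (T r)))"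
    using r by (subst finsum_even_odd) (auto simp: S_S intro!: finsum_cong')
  also have "\<dots> = norm_half r \<oplus> S 1 (norm_half r)"
    using r by (subst finsum_addf) (auto simp: norm_half_def S_finsum)
  finally show ?thesis .
qed

lemma norm_ax: "(\<Oplus>k\<in>{..<2 * m}. S (int k) (a \<otimes> x) \<oplus> S (int k) (T (a \<otimes> x))) = \<one>"
  using norm_full[of "a \<otimes> x"] by (simp add: norm_half_a trace_a)

end

section \<open>Dihedral groups\<close>

locale dihedral_group = group G for G (structure) +
  fixes \<sigma> \<tau> :: 'a and m :: nat
  assumes sigma_closed [simp]: "\<sigma> \<in> carrier G"
    and tau_closed [simp]: "\<tau> \<in> carrier G"
    and m_pos: "m > 0"
    and tau_sigma: "\<tau> \<otimes> \<sigma> = inv \<sigma> \<otimes> \<tau>"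
    and tau_tau [simp]: "\<tau> \<otimes> \<tau> = \<one>"
    and sigma_order: "\<sigma> [^] (2 * int m) = \<one>"
    and generates: "generate G {\<sigma>, \<tau>} = carrier G"
    and order: "order G = 4 * m"
begin

abbreviation P :: "int \<Rightarrow> 'a" where "P k \<equiv> \<sigma> [^] k"

lemma P_P: "P i \<otimes> P j = P (i + j)"
  by (simp add: int_pow_mult)

lemma P_P_assoc: "g \<in> carrier G \<Longrightarrow> P i \<otimes> (P j \<otimes> g) = P (i + j) \<otimes> g"
  by (simp add: int_pow_mult m_assoc)

section \<open>Normal forms of rotations and reflections\<close>

lemma tau_P_nat: "\<tau> \<otimes> P (int k) = P (- int k) \<otimes> \<tau>"
proof (induction k)
  case (Suc k)
  have "\<tau> \<otimes> P (int (Suc k)) = (\<tau> \<otimes> P (int k)) \<otimes> \<sigma>"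
    using P_P[of "int k" 1] by (simp add: m_assoc add.commute)
  also have "\<dots> = P (- int k) \<otimes> (P (- 1) \<otimes> \<tau>)"
    unfolding Suc by (simp add: m_assoc tau_sigma int_pow_neg)
  also have "\<dots> = P (- int (Suc k)) \<otimes> \<tau>"
    by (simp add: P_P_assoc algebra_simps)
  finally show ?case .
qed simp

lemma tau_P: "\<tau> \<otimes> P k = P (- k) \<otimes> \<tau>"
proof (cases k)
  case (nonneg i)
  then show ?thesis using tau_P_nat by simp
next
  case (neg i)
  define j where "j = int (Suc i)"
  \<comment> \<open>Multiplying the natural case by \<sigma>^j on the left and \<sigma>^(-j) on the
    right yields the negative case.\<close>
  have "P j \<otimes> (\<tau> \<otimes> P j) \<otimes> P (- j) = P j \<otimes> (P (- j) \<otimes> \<tau>) \<otimes> P (- j)"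
    by (simp only: j_def tau_P_nat)
  then have "P j \<otimes> \<tau> = \<tau> \<otimes> P (- j)"
    by (simp add: m_assoc P_P P_P_assoc)
  then show ?thesis using neg by (simp add: j_def add.commute)
qed

lemma tau_P_assoc: "g \<in> carrier G \<Longrightarrow> \<tau> \<otimes> (P k \<otimes> g) = P (- k) \<otimes> (\<tau> \<otimes> g)"
  using tau_P[of k] by (simp flip: m_assoc)

lemma P_period: "P (k + 2 * int m * j) = P k"
  using P_P[of k "2 * int m * j", symmetric] int_pow_pow[of \<sigma> "2 * int m" j, symmetric]
  by (simp add: sigma_order)

lemma P_mod: "P (k mod (2 * int m)) = P k"
  using P_period[of "k mod (2 * int m)" "k div (2 * int m)"] by simp

text \<open>The subgroup generated by \<sigma>^d and \<sigma>^e\<tau>. The pairs (1, 0), (2, 0) and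
  (m, 1) give G, U and U_2, so all three norms are treated together.\<close>

definition dihedral_set :: "int \<Rightarrow> int \<Rightarrow> 'a set" where
  "dihedral_set d e = {P (d * k) |k. True} \<union> {P (d * k + e) \<otimes> \<tau> |k. True}"

lemma dihedral_set_subgroup: "subgroup (dihedral_set d e) G"
proof (rule subgroupI)
  show "dihedral_set d e \<subseteq> carrier G" by (auto simp: dihedral_set_def)
  show "dihedral_set d e \<noteq> {}" by (auto simp: dihedral_set_def)
next
  fix g assume "g \<in> dihedral_set d e"
  then consider k where "g = P (d * k)" | k where "g = P (d * k + e) \<otimes> \<tau>"
    by (auto simp: dihedral_set_def)
  then show "inv g \<in> dihedral_set d e"
  proof cases
    case 1
    then have "inv g = P (d * (- k))" by (simp add: int_pow_neg)
    then show ?thesis unfolding dihedral_set_def by blast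
  next
    case 2
    then have "inv g = g" by (intro inv_equality) (simp_all add: m_assoc tau_P_assoc P_P P_P_assoc)
    then show ?thesis using 2 unfolding dihedral_set_def by blast
  qed
next
  fix g h assume "g \<in> dihedral_set d e" "h \<in> dihedral_set d e"
  moreover have "P (d * k) \<otimes> P (d * l) = P (d * (k + l))" for k l
    by (simp add: P_P algebra_simps)
  moreover have "P (d * k) \<otimes> (P (d * l + e) \<otimes> \<tau>) = P (d * (k + l) + e) \<otimes> \<tau>" for k l
    by (simp add: P_P_assoc algebra_simps)
  moreover have "P (d * k + e) \<otimes> \<tau> \<otimes> P (d * l) = P (d * (k - l) + e) \<otimes> \<tau>" for k l
    by (simp add: m_assoc tau_P P_P_assoc algebra_simps)
  moreover have "P (d * k + e) \<otimes> \<tau> \<otimes> (P (d * l + e) \<otimes> \<tau>) = P (d * (k - l))" for k l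
    by (simp add: m_assoc tau_P_assoc P_P algebra_simps)
  ultimately show "g \<otimes> h \<in> dihedral_set d e"
    unfolding dihedral_set_def by force
qed

lemma generate_eq_dihedral_set: "generate G {P d, P e \<otimes> \<tau>} = dihedral_set d e"
proof
  have "P (d * 1) \<in> dihedral_set d e" "P (d * 0 + e) \<otimes> \<tau> \<in> dihedral_set d e"
    unfolding dihedral_set_def by blast+
  then show "generate G {P d, P e \<otimes> \<tau>} \<subseteq> dihedral_set d e"
    using generate_subgroup_incl[OF _ dihedral_set_subgroup] by simp
next
  interpret H: subgroup "generate G {P d, P e \<otimes> \<tau>}" G
    by (intro generate_is_subgroup) auto
  have pow: "P (d * k) \<in> generate G {P d, P e \<otimes> \<tau>}" for k
    using subgroup_int_pow_closed[OF H.subgroup_axioms generate.incl, of "P d" k]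
    by (simp add: int_pow_pow)
  have "P (d * k + e) \<otimes> \<tau> \<in> generate G {P d, P e \<otimes> \<tau>}" for k
    using H.m_closed[OF pow[of k] generate.incl[of "P e \<otimes> \<tau>"]] by (simp add: P_P_assoc)
  then show "dihedral_set d e \<subseteq> generate G {P d, P e \<otimes> \<tau>}"
    using pow by (auto simp: dihedral_set_def)
qed

text \<open>Here (\<sigma>^d)^N = 1, so the multiplier of \<open>d\<close> matters only modulo
  \<open>N\<close>.\<close>

lemma dihedral_set_finite:
  assumes "d * N = 2 * m"
  shows "dihedral_set (int d) e =
    (\<lambda>i. P (int (d * i))) ` {..<N} \<union> (\<lambda>i. P (int (d * i) + e) \<otimes> \<tau>) ` {..<N}"
proof
  have "N > 0" using assms m_pos by (cases N) auto
  have red: "P (int d * k + c) = P (int (d * nat (k mod int N)) + c)" for k c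
  proof -
    have "int d * int N = 2 * int m"
      using arg_cong[OF assms, of int] by simp
    then have "int d * k = int d * (k mod int N) + 2 * int m * (k div int N)"
      by (metis distrib_left mod_mult_div_eq mult.assoc)
    then have "int d * k + c = int d * (k mod int N) + c + 2 * int m * (k div int N)"
      by simp
    then have "P (int d * k + c) = P (int d * (k mod int N) + c)"
      by (simp only: P_period)
    then show ?thesis
      using \<open>N > 0\<close> by simp
  qed
  have N: "nat (k mod int N) \<in> {..<N}" for k
    using \<open>N > 0\<close> by (simp add: nat_less_iff)
  have "P (int d * k) \<in> (\<lambda>i. P (int (d * i))) ` {..<N}"
    "P (int d * k + e) \<otimes> \<tau> \<in> (\<lambda>i. P (int (d * i) + e) \<otimes> \<tau>) ` {..<N}" for k
    using red[of k 0] red[of k e] by (auto intro!: image_eqI[OF _ N[of k]])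
  then show "dihedral_set (int d) e \<subseteq>
    (\<lambda>i. P (int (d * i))) ` {..<N} \<union> (\<lambda>i. P (int (d * i) + e) \<otimes> \<tau>) ` {..<N}"
    by (auto simp only: dihedral_set_def)
next
  show "(\<lambda>i. P (int (d * i))) ` {..<N} \<union> (\<lambda>i. P (int (d * i) + e) \<otimes> \<tau>) ` {..<N} \<subseteq> dihedral_set (int d) e"
    by (auto simp: dihedral_set_def)
qed

lemma carrier_eq: "carrier G = dihedral_set 1 0"
  using generate_eq_dihedral_set[of 1 0] generates by simp

text \<open>By counting: at most 2m rotations and at most 2m reflections cover a group of order 4m,
  so neither list has repetitions and the two are disjoint.\<close>

lemma rotations_reflections:
  shows P_inj: "inj_on (\<lambda>i. P (int i)) {..<2 * m}"
    and P_not_reflection: "P i \<noteq> P j \<otimes> \<tau>"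
proof -
  let ?A = "(\<lambda>i. P (int i)) ` {..<2 * m}" and ?B = "(\<lambda>i. P (int i) \<otimes> \<tau>) ` {..<2 * m}"
  have "card (?A \<union> ?B) = 4 * m"
    using dihedral_set_finite[of 1 "2 * m" 0] carrier_eq order by (simp add: order_def)
  moreover have "card ?A \<le> 2 * m" "card ?B \<le> 2 * m"
    using card_image_le[of "{..<2 * m}"] by auto
  moreover have "card (?A \<union> ?B) + card (?A \<inter> ?B) = card ?A + card ?B"
    by (intro card_Un_Int[symmetric]) auto
  ultimately have A: "card ?A = 2 * m" and "card (?A \<inter> ?B) = 0"
    by linarith+
  then have AB: "?A \<inter> ?B = {}"
    by simp
  show "inj_on (\<lambda>i. P (int i)) {..<2 * m}"
    using A by (intro eq_card_imp_inj_on) auto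
  have "P k \<in> ?A" "P k \<otimes> \<tau> \<in> ?B" for k
  proof -
    define i where "i = nat (k mod (2 * int m))"
    have "i < 2 * m" "P k = P (int i)"
      using m_pos P_mod[of k] by (simp_all add: i_def nat_less_iff)
    then show "P k \<in> ?A" "P k \<otimes> \<tau> \<in> ?B" by auto
  qed
  then show "P i \<noteq> P j \<otimes> \<tau>"
    using AB by (metis IntI empty_iff)
qed

lemma P_inj_on:
  assumes "d * N = 2 * m"
  shows "inj_on (\<lambda>i. P (int (d * i))) {..<N}"
proof (rule inj_onI)
  fix i j assume "i \<in> {..<N}" "j \<in> {..<N}" and eq: "P (int (d * i)) = P (int (d * j))"
  moreover have "d > 0" using assms m_pos by (cases d) auto
  ultimately have "d * i < 2 * m" "d * j < 2 * m"
    by (simp_all flip: assms)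
  then have "d * i = d * j"
    using inj_onD[OF P_inj eq] by simp
  then show "i = j" using \<open>d > 0\<close> by simp
qed

lemma finsum_dihedral_set:
  assumes "abelian_group R" "d * N = 2 * m" "\<And>g. g \<in> carrier G \<Longrightarrow> f g \<in> carrier R"
  shows "(\<Oplus>\<^bsub>R\<^esub>g\<in>dihedral_set (int d) e. f g)
    = (\<Oplus>\<^bsub>R\<^esub>i\<in>{..<N}. f (P (int (d * i))) \<oplus>\<^bsub>R\<^esub> f (P (int (d * i) + e) \<otimes> \<tau>))"
proof -
  interpret R: abelian_group R by fact
  have inj: "inj_on (\<lambda>i. P (int (d * i) + e) \<otimes> \<tau>) {..<N}"
  proof (rule inj_onI)
    fix i j assume *: "i \<in> {..<N}" "j \<in> {..<N}"
      and "P (int (d * i) + e) \<otimes> \<tau> = P (int (d * j) + e) \<otimes> \<tau>"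
    then have "P (int (d * i)) \<otimes> P e = P (int (d * j)) \<otimes> P e"
      by (simp add: P_P)
    then show "i = j"
      using inj_onD[OF P_inj_on[OF assms(2)]] * by simp
  qed
  have "(\<Oplus>\<^bsub>R\<^esub>g\<in>dihedral_set (int d) e. f g) =
      (\<Oplus>\<^bsub>R\<^esub>g\<in>(\<lambda>i. P (int (d * i))) ` {..<N}. f g) \<oplus>\<^bsub>R\<^esub>
      (\<Oplus>\<^bsub>R\<^esub>g\<in>(\<lambda>i. P (int (d * i) + e) \<otimes> \<tau>) ` {..<N}. f g)"
    unfolding dihedral_set_finite[OF assms(2)]
    by (rule R.finsum_Un_disjoint) (use P_not_reflection in \<open>auto intro!: assms(3)\<close>)
  also have "\<dots> = (\<Oplus>\<^bsub>R\<^esub>i\<in>{..<N}. f (P (int (d * i)))) \<oplus>\<^bsub>R\<^esub>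
      (\<Oplus>\<^bsub>R\<^esub>i\<in>{..<N}. f (P (int (d * i) + e) \<otimes> \<tau>))"
    by (intro arg_cong2[where f = "add R"] R.finsum_reindex inj P_inj_on assms(2)) (auto intro!: assms(3))
  also have "\<dots> = (\<Oplus>\<^bsub>R\<^esub>i\<in>{..<N}. f (P (int (d * i))) \<oplus>\<^bsub>R\<^esub> f (P (int (d * i) + e) \<otimes> \<tau>))"
    by (intro R.finsum_addf[symmetric]) (auto intro!: assms(3))
  finally show ?thesis .
qed

end

section \<open>The polynomial\<close>

lemma gr_act_eq_lin_ext: "gr_act R \<phi> c r = lin_ext R (\<lambda>g. \<phi> g r) c"
  by (simp add: gr_act_def lin_ext_def)

lemma ncpoly_eval_eq_lin_ext: "ncpoly_eval R \<rho> c = lin_ext R (word_eval R \<rho>) c"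
  by (simp add: ncpoly_eval_def lin_ext_def)

context ring begin

lemma gr_act_add:
  "\<phi> g r \<in> carrier R \<Longrightarrow> \<phi> h r \<in> carrier R \<Longrightarrow> gr_act R \<phi> (gr g + gr h) r = \<phi> g r \<oplus> \<phi> h r"
  unfolding gr_act_eq_lin_ext by (subst lin_ext_add) (auto simp: lin_ext_single)

lemma gr_act_diff:
  "\<phi> g r \<in> carrier R \<Longrightarrow> \<phi> h r \<in> carrier R \<Longrightarrow> gr_act R \<phi> (gr g - gr h) r = \<phi> g r \<ominus> \<phi> h r"
  unfolding gr_act_eq_lin_ext by (subst lin_ext_diff) (auto simp: lin_ext_single)

end

context dihedral_group begin

abbreviation U :: "'a set" where
  "U \<equiv> dihedral_set 2 0"

abbreviation word :: "('a \<times> symbol) list \<Rightarrow> ('a \<times> symbol) ncpoly" where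
  "word v \<equiv> Poly_Mapping.single v 1"

text \<open>The translate \<open>\<sigma>(b(\<sigma>))\<close> occurring in \<open>b(\<sigma>\<^sup>2)\<close> is not a translate under \<open>U\<close>;
  it is replaced by \<open>u\<sigma>\<^sup>2\<tau>(b(\<sigma>))\<close>, which has the same value.\<close>

definition b_term_poly :: "nat \<Rightarrow> 'a \<Rightarrow> ('a \<times> symbol) ncpoly" where
  "b_term_poly j g = word [(P (2 * int j), B_sigma), (g, Norm_one)]
     + word [(P (2 * int j + int m + 2) \<otimes> \<tau>, B_sigma), (g, Norm_one)] - word [(g, Norm_one)]"

text \<open>Its value is \<open>B i\<close> times g(x); the factor g(x) is already the last letter
  of every word.\<close>

definition b_times_poly :: "nat \<Rightarrow> 'a \<Rightarrow> ('a \<times> symbol) ncpoly" where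
  "b_times_poly i g = (\<Sum>j<i. b_term_poly j g)"

definition summand_poly :: "nat \<Rightarrow> ('a \<times> symbol) ncpoly" where
  "summand_poly i = b_times_poly i (P (2 * int i)) + (b_times_poly i (P (2 * int i) \<otimes> \<tau>)
     + word [(P (2 * int i), B_tau), (P (2 * int i) \<otimes> \<tau>, Norm_one)])"

definition w_poly :: "('a \<times> symbol) ncpoly" where
  "w_poly = - (\<Sum>i<m. summand_poly i)"

lemma even_in_U: "even k \<Longrightarrow> P k \<in> U" "even k \<Longrightarrow> P k \<otimes> \<tau> \<in> U"
  by (auto simp: dihedral_set_def elim!: evenE)

text \<open>Evenness of \<open>m\<close> enters through the exponent 2j + m + 2, which must be even
  for the translate to be by an element of U.\<close>

lemma keys_b_term_poly:
  assumes "even m" "g \<in> U"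
  shows "Poly_Mapping.keys (b_term_poly j g) \<subseteq> lists (U \<times> UNIV)"
  unfolding b_term_poly_def
  using assms even_in_U[of "2 * int j"] even_in_U[of "2 * int j + int m + 2"]
  by (intro order_trans[OF keys_diff] Un_least order_trans[OF Poly_Mapping.keys_add]) auto

lemma keys_b_times_poly:
  assumes "even m" "g \<in> U"
  shows "Poly_Mapping.keys (b_times_poly i g) \<subseteq> lists (U \<times> UNIV)"
  unfolding b_times_poly_def using keys_b_term_poly[OF assms]
  by (intro order_trans[OF Poly_Mapping.keys_sum]) blast

lemma keys_summand_poly: "even m \<Longrightarrow> Poly_Mapping.keys (summand_poly i) \<subseteq> lists (U \<times> UNIV)"
  unfolding summand_poly_def
  by (intro Un_least order_trans[OF Poly_Mapping.keys_add] keys_b_times_poly)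
    (auto intro: even_in_U)

lemma keys_w_poly: "even m \<Longrightarrow> Poly_Mapping.keys w_poly \<subseteq> lists (U \<times> UNIV)"
  unfolding w_poly_def using keys_summand_poly
  by (simp, intro order_trans[OF Poly_Mapping.keys_sum]) blast

end

section \<open>The group action and the value of the polynomial\<close>

locale dihedral_norm_problem = dihedral_group G \<sigma> \<tau> m
  for G :: "('g, 'm) monoid_scheme" (structure) and \<sigma> \<tau> :: 'g and m :: nat +
  fixes R :: "('r, 'k) ring_scheme" and \<phi> :: "'g \<Rightarrow> 'r \<Rightarrow> 'r" and x z :: 'r
  assumes even_m: "even m"
    and ring_R: "ring R"
    and acts: "acts_by_ring_automorphisms G R \<phi>"
    and x_in: "x \<in> carrier R"
    and z_in: "z \<in> carrier R"
    and norm_x: "action_norm R \<phi> U x = \<one>\<^bsub>R\<^esub>"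
    and norm_z: "action_norm R \<phi> (dihedral_set (int m) 1) z = \<one>\<^bsub>R\<^esub>"
begin

sublocale R: ring R by (rule ring_R)

lemma act_hom: "g \<in> carrier G \<Longrightarrow> \<phi> g \<in> ring_hom R R"
  using acts by (auto simp: acts_by_ring_automorphisms_def ring_iso_def)

lemma act_closed [simp]: "g \<in> carrier G \<Longrightarrow> r \<in> carrier R \<Longrightarrow> \<phi> g r \<in> carrier R"
  using ring_hom_closed[OF act_hom] by blast

lemma act_act:
  assumes "g \<in> carrier G" "h \<in> carrier G" "r \<in> carrier R"
  shows "\<phi> g (\<phi> h r) = \<phi> (g \<otimes> h) r"
proof -
  interpret group_action G "carrier R" \<phi>
    using acts by (simp add: acts_by_ring_automorphisms_def)
  show ?thesis using assms by (simp add: composition_rule)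
qed

lemma act_one: "r \<in> carrier R \<Longrightarrow> \<phi> \<one> r = r"
proof -
  interpret group_action G "carrier R" \<phi>
    using acts by (simp add: acts_by_ring_automorphisms_def)
  show "r \<in> carrier R \<Longrightarrow> \<phi> \<one> r = r" by (simp flip: id_eq_one)
qed

lemma action_norm_dihedral_set:
  assumes "d * N = 2 * m" "r \<in> carrier R"
  shows "action_norm R \<phi> (dihedral_set (int d) e) r
    = (\<Oplus>\<^bsub>R\<^esub>i\<in>{..<N}. \<phi> (P (int (d * i))) r \<oplus>\<^bsub>R\<^esub> \<phi> (P (int (d * i) + e) \<otimes> \<tau>) r)"
  unfolding action_norm_def using assms
  by (intro finsum_dihedral_set R.abelian_group_axioms) auto

sublocale A: dihedral_ring_action R "\<lambda>k. \<phi> (P k)" "\<phi> \<tau>" m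
  by unfold_locales (auto intro: act_hom simp: act_act P_P sigma_order act_one tau_P)

lemma norm_U: "r \<in> carrier R \<Longrightarrow> action_norm R \<phi> U r = A.norm_half r"
  using action_norm_dihedral_set[of 2 m r 0]
  by (simp add: A.norm_half_def act_act)

sublocale N: dihedral_norm_one R "\<lambda>k. \<phi> (P k)" "\<phi> \<tau>" m x z
proof unfold_locales
  show "A.norm_half x = \<one>\<^bsub>R\<^esub>"
    using norm_x norm_U x_in by simp
  show "z \<oplus>\<^bsub>R\<^esub> \<phi> (P (int m)) z \<oplus>\<^bsub>R\<^esub> (\<phi> (P 1) (\<phi> \<tau> z) \<oplus>\<^bsub>R\<^esub> \<phi> (P (int m + 1)) (\<phi> \<tau> z)) = \<one>\<^bsub>R\<^esub>"
    \<comment> \<open>For U_2 there are only the two rotations 1 and u, hence a sum over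
      \<open>i < 2\<close>.\<close>
    using action_norm_dihedral_set[of m 2 z 1] norm_z z_in
    by (simp add: numeral_2_eq_2 lessThan_Suc act_act act_one R.a_ac del: int_pow_1)
qed (fact x_in z_in)+

lemma U_carrier: "g \<in> U \<Longrightarrow> g \<in> carrier G"
  by (auto simp: dihedral_set_def)

lemma eval_w_poly: "ncpoly_eval R (translate_val \<phi> x N.bs N.bt) w_poly = N.w"
proof -
  define f where "f = word_eval R (translate_val \<phi> x N.bs N.bt)"
  \<comment> \<open>Only variables with group part in U are known to take values in the ring, so
    each use of additivity below comes with a bound on the keys.\<close>
  have translate: "translate_val \<phi> x N.bs N.bt (g, s) \<in> carrier R" if "g \<in> U" for g s
    using U_carrier[OF that] by (cases s) (auto simp: translate_val_def)
  have f_closed: "f v \<in> carrier R" if "v \<in> lists (U \<times> UNIV)" for v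
    using that unfolding f_def
    by (induction v) (auto simp: word_eval_def intro!: translate)
  have add: "lin_ext R f (c + d) = lin_ext R f c \<oplus>\<^bsub>R\<^esub> lin_ext R f d"
    if "Poly_Mapping.keys c \<subseteq> lists (U \<times> UNIV)" "Poly_Mapping.keys d \<subseteq> lists (U \<times> UNIV)" for c d
    using that f_closed by (intro R.lin_ext_add) blast
  have single: "lin_ext R f (word v) = f v" if "v \<in> lists (U \<times> UNIV)" for v
    by (intro R.lin_ext_single f_closed that)
  have word1: "f [(g, Norm_one)] = \<phi> g x" if "g \<in> U" for g
    using U_carrier[OF that] by (simp add: f_def word_eval_def translate_val_def)
  have word2: "f [(g, s), (h, Norm_one)] = \<phi> g (symbol_val x N.bs N.bt s) \<otimes>\<^bsub>R\<^esub> \<phi> h x"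
    if "g \<in> U" "h \<in> U" for g h s
    using U_carrier[OF that(1)] U_carrier[OF that(2)]
    by (cases s) (simp_all add: f_def word_eval_def translate_val_def)
  have b_term: "lin_ext R f (b_term_poly j g) = \<phi> (P (2 * int j)) N.bss \<otimes>\<^bsub>R\<^esub> \<phi> g x"
    if g: "g \<in> U" for j g
  proof -
    let ?p = "word [(P (2 * int j), B_sigma), (g, Norm_one)]"
    let ?q = "word [(P (2 * int j + int m + 2) \<otimes> \<tau>, B_sigma), (g, Norm_one)]"
    let ?r = "word [(g, Norm_one)]"
    have U: "P (2 * int j) \<in> U" "P (2 * int j + int m + 2) \<otimes> \<tau> \<in> U"
      using even_m by (auto intro: even_in_U)
    have keys: "Poly_Mapping.keys ?p \<subseteq> lists (U \<times> UNIV)" "Poly_Mapping.keys ?q \<subseteq> lists (U \<times> UNIV)"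
      "Poly_Mapping.keys ?r \<subseteq> lists (U \<times> UNIV)"
      using g U by auto
    have "lin_ext R f (b_term_poly j g) = lin_ext R f (?p + ?q) \<ominus>\<^bsub>R\<^esub> lin_ext R f ?r"
      unfolding b_term_poly_def
      using keys Poly_Mapping.keys_add[of ?p ?q] by (intro R.lin_ext_diff f_closed) blast
    also have "lin_ext R f (?p + ?q) = lin_ext R f ?p \<oplus>\<^bsub>R\<^esub> lin_ext R f ?q"
      using keys by (intro add)
    also have "lin_ext R f ?p = \<phi> (P (2 * int j)) N.bs \<otimes>\<^bsub>R\<^esub> \<phi> g x"
      using g U by (simp add: single word2)
    \<comment> \<open>\<open>S_1_bs\<close> identifies this U-translate with the term of
      \<open>bss\<close> coming from \<sigma>(b(\<sigma>)).\<close>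
    also have "lin_ext R f ?q = \<phi> (P (2 * int j)) (\<phi> (P 1) N.bs) \<otimes>\<^bsub>R\<^esub> \<phi> g x"
      unfolding N.S_1_bs using g U U_carrier[OF g]
      by (simp add: single word2 A.S_S act_act P_P P_P_assoc add.assoc)
    also have "lin_ext R f ?r = \<phi> g x"
      using g by (simp add: single word1)
    finally show ?thesis
      using U_carrier[OF g]
      by (simp add: N.bss_def R.l_distr R.minus_eq R.l_minus del: int_pow_1)
  qed
  have b_times: "lin_ext R f (b_times_poly i g) = N.B i \<otimes>\<^bsub>R\<^esub> \<phi> g x" if g: "g \<in> U" for i g
  proof -
    have "lin_ext R f (b_times_poly i g) = (\<Oplus>\<^bsub>R\<^esub>j\<in>{..<i}. lin_ext R f (b_term_poly j g))"
      unfolding b_times_poly_def using keys_b_term_poly[OF even_m g]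
      by (intro R.lin_ext_sum f_closed) auto
    also have "\<dots> = (\<Oplus>\<^bsub>R\<^esub>j\<in>{..<i}. \<phi> (P (2 * int j)) N.bss \<otimes>\<^bsub>R\<^esub> \<phi> g x)"
      using U_carrier[OF g] by (intro R.finsum_cong') (auto simp: b_term[OF g])
    also have "\<dots> = N.B i \<otimes>\<^bsub>R\<^esub> \<phi> g x"
      unfolding N.B_def using U_carrier[OF g] by (intro R.finsum_ldistr[symmetric]) auto
    finally show ?thesis .
  qed
  have summand: "lin_ext R f (summand_poly i) = N.F i" for i
  proof -
    let ?g = "P (2 * int i)" and ?h = "P (2 * int i) \<otimes> \<tau>"
    let ?r = "word [(?g, B_tau), (?h, Norm_one)]"
    have U: "?g \<in> U" "?h \<in> U"
      by (auto intro: even_in_U)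
    have keys: "Poly_Mapping.keys ?r \<subseteq> lists (U \<times> UNIV)"
      using U by auto
    have keys': "Poly_Mapping.keys (b_times_poly i ?h + ?r) \<subseteq> lists (U \<times> UNIV)"
      by (intro order_trans[OF Poly_Mapping.keys_add] Un_least keys keys_b_times_poly even_m U)
    have "lin_ext R f (summand_poly i) = lin_ext R f (b_times_poly i ?g)
        \<oplus>\<^bsub>R\<^esub> (lin_ext R f (b_times_poly i ?h) \<oplus>\<^bsub>R\<^esub> lin_ext R f ?r)"
      unfolding summand_poly_def
      by (simp only: add keys keys' keys_b_times_poly even_m U)
    also have "\<dots> = N.F i"
      using U by (simp add: b_times single word2 N.F_def R.l_distr act_act)
    finally show ?thesis .
  qed
  have keys: "Poly_Mapping.keys (\<Sum>i<m. summand_poly i) \<subseteq> lists (U \<times> UNIV)"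
    using keys_w_poly[OF even_m] by (simp add: w_poly_def)
  have "lin_ext R f w_poly = \<ominus>\<^bsub>R\<^esub> lin_ext R f (\<Sum>i<m. summand_poly i)"
    unfolding w_poly_def using keys by (intro R.lin_ext_uminus f_closed) blast
  also have "lin_ext R f (\<Sum>i<m. summand_poly i) = (\<Oplus>\<^bsub>R\<^esub>i\<in>{..<m}. lin_ext R f (summand_poly i))"
    using keys_summand_poly[OF even_m] by (intro R.lin_ext_sum f_closed) auto
  also have "\<dots> = (\<Oplus>\<^bsub>R\<^esub>i\<in>{..<m}. N.F i)"
    by (simp only: summand)
  finally show ?thesis
    by (simp only: N.w_def f_def ncpoly_eval_eq_lin_ext)
qed

section \<open>The quotient by U and the norm over G\<close>

lemma subgroup_U: "subgroup U G"
  by (rule dihedral_set_subgroup)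

text \<open>Uniqueness of normal forms: \<sigma> is no reflection, and the exponents 1 and 2i, both
  below 2m, differ by parity.\<close>

lemma sigma_notin_U: "\<sigma> \<notin> U"
proof
  assume "\<sigma> \<in> U"
  then consider i where "i < m" "P 1 = P (int (2 * i))" | i where "P 1 = P (int (2 * i)) \<otimes> \<tau>"
    using dihedral_set_finite[of 2 m 0] by auto
  then show False
  proof cases
    case 1
    then have "1 = 2 * i"
      using m_pos by (intro inj_onD[OF P_inj]) auto
    then show False by presburger
  qed (use P_not_reflection in blast)
qed

lemma cosets_U: "carrier (G Mod U) = {U, U #> \<sigma>}"
proof -
  have "U #> g = U \<or> U #> g = U #> \<sigma>" if "g \<in> carrier G" for g
  proof -
    from that obtain k where k: "g = P k \<or> g = P k \<otimes> \<tau>"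
      unfolding carrier_eq by (auto simp: dihedral_set_def)
    show ?thesis
    proof (cases "even k")
      case True
      then have "g \<in> U" using k even_in_U by blast
      then show ?thesis using coset_join2[OF that subgroup_U] by blast
    next
      case False
      \<comment> \<open>For odd k, dividing by \<sigma> makes the exponent even: k - 1 for a
        rotation and k + 1 for a reflection.\<close>
      define h where "h = g \<otimes> inv \<sigma>"
      have "P k \<otimes> inv \<sigma> = P (k - 1)" "P k \<otimes> \<tau> \<otimes> inv \<sigma> = P (k + 1) \<otimes> \<tau>"
        using P_P[of k "-1"] P_P[of k 1] tau_P[of "-1"]
        by (simp_all add: int_pow_neg m_assoc flip: m_assoc[of _ \<sigma> \<tau>])
      then have "h \<in> U"
        using k False even_in_U by (auto simp: h_def)
      moreover have "g = h \<otimes> \<sigma>"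
        using that by (simp add: h_def m_assoc)
      ultimately have "U #> g = U #> \<sigma>"
        using coset_mult_assoc[of U h \<sigma>] coset_join2[OF _ subgroup_U] U_carrier by auto
      then show ?thesis ..
    qed
  qed
  moreover have "U #> \<one> = U"
    using coset_join2[OF _ subgroup_U] subgroup.one_closed[OF subgroup_U] by blast
  ultimately show ?thesis
    unfolding FactGroup_def RCOSETS_def by (auto intro!: bexI[of _ \<one>] bexI[of _ \<sigma>])
qed

lemma act_U_a: "g \<in> U \<Longrightarrow> \<phi> g N.a = N.a"
  using dihedral_set_finite[of 2 m 0] N.S_even_a
  by (auto simp: N.T_a simp flip: act_act)

text \<open>Elements of the right coset are h g with h acting last, so invariance is asked of
  \<open>\<phi> g N.a\<close>; the image is then a singleton and \<open>the_elem\<close> returns its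
  member.\<close>

lemma quotient_action_coset:
  assumes "g \<in> carrier G" "\<And>h. h \<in> U \<Longrightarrow> \<phi> h (\<phi> g N.a) = \<phi> g N.a"
  shows "quotient_action \<phi> (U #> g) N.a = \<phi> g N.a"
proof -
  have "\<phi> k N.a = \<phi> g N.a" if "k \<in> U #> g" for k
    using that assms U_carrier by (auto simp: r_coset_def simp flip: act_act)
  moreover have "g \<in> U #> g"
    using rcos_self[OF assms(1) subgroup_U] .
  ultimately have "(\<lambda>k. \<phi> k N.a) ` (U #> g) = {\<phi> g N.a}"
    by blast
  then show ?thesis
    by (simp add: quotient_action_def)
qed

lemma quotient_norm_a:
  "action_norm R (quotient_action \<phi>) (carrier (G Mod U)) N.a = N.a \<oplus>\<^bsub>R\<^esub> \<phi> \<sigma> N.a"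
proof -
  have "\<phi> h (\<phi> \<sigma> N.a) = \<phi> \<sigma> N.a" if h: "h \<in> U" for h
  proof -
    have hom: "\<phi> h \<in> ring_hom R R"
      using act_hom U_carrier[OF h] .
    \<comment> \<open>Since \<open>h\<close> fixes both a and a + \<sigma>(a) = 1, it fixes
      \<sigma>(a).\<close>
    have "N.a \<oplus>\<^bsub>R\<^esub> \<phi> h (\<phi> \<sigma> N.a) = \<phi> h (N.a \<oplus>\<^bsub>R\<^esub> \<phi> \<sigma> N.a)"
      using ring_hom_add[OF hom, of N.a "\<phi> \<sigma> N.a"] by (simp add: act_U_a[OF h])
    also have "\<dots> = N.a \<oplus>\<^bsub>R\<^esub> \<phi> \<sigma> N.a"
      using N.trace_a ring_hom_one[OF hom] by simp
    finally show ?thesis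
      using U_carrier[OF h] by (subst (asm) R.add.l_cancel) auto
  qed
  then have "quotient_action \<phi> (U #> \<sigma>) N.a = \<phi> \<sigma> N.a"
    by (intro quotient_action_coset) auto
  moreover have U_one: "U #> \<one> = U"
    using coset_join2[OF _ subgroup_U] subgroup.one_closed[OF subgroup_U] by blast
  then have "quotient_action \<phi> U N.a = N.a"
    using quotient_action_coset[of \<one>] act_U_a by (simp add: act_one)
  moreover have "U \<noteq> U #> \<sigma>"
    using rcos_self[OF sigma_closed subgroup_U] sigma_notin_U by blast
  ultimately show ?thesis
    by (simp add: action_norm_def cosets_U)
qed

lemma norm_G: "action_norm R \<phi> (carrier G) (N.a \<otimes>\<^bsub>R\<^esub> x) = \<one>\<^bsub>R\<^esub>"
proof -
  define y where "y = N.a \<otimes>\<^bsub>R\<^esub> x"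
  have y: "y \<in> carrier R" by (simp add: y_def)
  have "action_norm R \<phi> (carrier G) y
      = (\<Oplus>\<^bsub>R\<^esub>k\<in>{..<2 * m}. \<phi> (P (int k)) y \<oplus>\<^bsub>R\<^esub> \<phi> (P (int k) \<otimes> \<tau>) y)"
    using action_norm_dihedral_set[of 1 "2 * m" y 0] y by (simp add: carrier_eq del: R.finsum_addf)
  also have "\<dots> = (\<Oplus>\<^bsub>R\<^esub>k\<in>{..<2 * m}. \<phi> (P (int k)) y \<oplus>\<^bsub>R\<^esub> \<phi> (P (int k)) (\<phi> \<tau> y))"
    using y by (intro R.finsum_cong') (auto simp: act_act)
  also have "\<dots> = \<one>\<^bsub>R\<^esub>"
    using N.norm_ax by (simp only: y_def)
  finally show ?thesis
    by (simp only: y_def)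
qed

end

theorem mainTheorem4:
  fixes G :: "('g, 'm) monoid_scheme" and n :: nat and \<sigma> \<tau> u :: 'g and U U2 :: "'g set"
  assumes "n \<ge> 2"
    and "dihedral_generators G n \<sigma> \<tau>"
    and "u = \<sigma> [^]\<^bsub>G\<^esub> ((2::nat) ^ (n - 1))"
    and "U = generate G {\<sigma> [^]\<^bsub>G\<^esub> (2::nat), \<tau>}"
    and "U2 = generate G {u, \<sigma> \<otimes>\<^bsub>G\<^esub> \<tau>}"
  shows "\<exists>P :: ('g \<times> symbol) ncpoly. ncpoly_vars P \<subseteq> U \<times> UNIV \<and>
    (\<forall>(R :: ('r, 'k) ring_scheme) \<phi> x x2 b_sigma b_tau b_sigma_sq.
       ring R \<longrightarrow> acts_by_ring_automorphisms G R \<phi> \<longrightarrow>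
       x \<in> carrier R \<longrightarrow> action_norm R \<phi> U x = \<one>\<^bsub>R\<^esub> \<longrightarrow>
       x2 \<in> carrier R \<longrightarrow> action_norm R \<phi> U2 x2 = \<one>\<^bsub>R\<^esub> \<longrightarrow>
       b_sigma = gr_act R \<phi> (gr \<sigma> + gr (u \<otimes>\<^bsub>G\<^esub> \<tau>)) x2 \<longrightarrow>
       b_tau = gr_act R \<phi> (gr \<tau> - gr \<one>\<^bsub>G\<^esub>) (gr_act R \<phi> (gr \<one>\<^bsub>G\<^esub> + gr u) x2) \<longrightarrow>
       b_sigma_sq = gr_act R \<phi> (gr \<one>\<^bsub>G\<^esub> + gr \<sigma>) b_sigma \<ominus>\<^bsub>R\<^esub> \<one>\<^bsub>R\<^esub> \<longrightarrow>
       (\<exists>w \<in> carrier R.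
          w = ncpoly_eval R (translate_val \<phi> x b_sigma b_tau) P \<and>
          b_sigma_sq = gr_act R \<phi> (gr (\<sigma> [^]\<^bsub>G\<^esub> (2::nat)) - gr \<one>\<^bsub>G\<^esub>) w \<and>
          b_tau = gr_act R \<phi> (gr \<tau> - gr \<one>\<^bsub>G\<^esub>) w \<and>
          (let a = b_sigma \<oplus>\<^bsub>R\<^esub> gr_act R \<phi> (gr \<one>\<^bsub>G\<^esub> - gr \<sigma>) w;
               y = a \<otimes>\<^bsub>R\<^esub> x
           in a \<in> fixed_subring R \<phi> U \<and>
              action_norm R (quotient_action \<phi>) (carrier (G Mod U)) a
                = gr_act R \<phi> (gr \<one>\<^bsub>G\<^esub> + gr \<sigma>) a \<and>
              gr_act R \<phi> (gr \<one>\<^bsub>G\<^esub> + gr \<sigma>) a = \<one>\<^bsub>R\<^esub> \<and>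
              action_norm R \<phi> (carrier G) y = \<one>\<^bsub>R\<^esub>)))"
proof -
  \<comment> \<open>With this choice u = \<sigma>^m and G has order 4m; \<open>n \<ge> 2\<close>
    makes \<open>m\<close> even.\<close>
  define m :: nat where "m = 2 ^ (n - 1)"
  have n: "n - 1 = Suc (n - 2)" "n = Suc (n - 1)"
    using assms(1) by auto
  have two_m: "2 ^ n = 2 * m" "2 ^ (n + 1) = 4 * m"
    unfolding m_def by (subst n(2); simp)+
  have even_m: "even m"
    unfolding m_def by (subst n(1)) simp
  have dih: "dihedral_group G \<sigma> \<tau> m"
  proof (intro dihedral_group.intro dihedral_group_axioms.intro)
    show "group G" using assms(2) by (simp add: dihedral_generators_def)
    then interpret group G .
    show "\<sigma> \<in> carrier G" "\<tau> \<in> carrier G" "generate G {\<sigma>, \<tau>} = carrier G"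
      "\<tau> \<otimes>\<^bsub>G\<^esub> \<sigma> = inv\<^bsub>G\<^esub> \<sigma> \<otimes>\<^bsub>G\<^esub> \<tau>" "Coset.order G = 4 * m" "m > 0"
      "\<tau> \<otimes>\<^bsub>G\<^esub> \<tau> = \<one>\<^bsub>G\<^esub>" "\<sigma> [^]\<^bsub>G\<^esub> (2 * int m) = \<one>\<^bsub>G\<^esub>"
      using assms(2) two_m int_pow_int[of G \<sigma> "2 * m"]
      by (auto simp: dihedral_generators_def m_def numeral_2_eq_2)
  qed
  interpret D: dihedral_group G \<sigma> \<tau> m by (rule dih)
  have u: "u = D.P (int m)"
    by (simp add: assms(3) m_def flip: int_pow_int)
  have sigma_sq: "\<sigma> [^]\<^bsub>G\<^esub> (2::nat) = D.P 2"
    using int_pow_int[of G \<sigma> 2] by simp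
  have U: "U = D.U"
    using D.generate_eq_dihedral_set[of 2 0] by (simp add: assms(4) sigma_sq)
  have U2: "U2 = D.dihedral_set (int m) 1"
    using D.generate_eq_dihedral_set[of "int m" 1] by (simp add: assms(5) u)
  \<comment> \<open>The witness is built from the group alone, so one polynomial serves all rings,
    actions and norm one elements.\<close>
  have "ncpoly_vars D.w_poly \<subseteq> U \<times> UNIV"
    using D.keys_w_poly[OF even_m] unfolding U ncpoly_vars_def by (auto simp: in_lists_conv_set subset_iff)
  moreover have "\<exists>w \<in> carrier R.
          w = ncpoly_eval R (translate_val \<phi> x b_sigma b_tau) D.w_poly \<and>
          b_sigma_sq = gr_act R \<phi> (gr (\<sigma> [^]\<^bsub>G\<^esub> (2::nat)) - gr \<one>\<^bsub>G\<^esub>) w \<and>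
          b_tau = gr_act R \<phi> (gr \<tau> - gr \<one>\<^bsub>G\<^esub>) w \<and>
          (let a = b_sigma \<oplus>\<^bsub>R\<^esub> gr_act R \<phi> (gr \<one>\<^bsub>G\<^esub> - gr \<sigma>) w;
               y = a \<otimes>\<^bsub>R\<^esub> x
           in a \<in> fixed_subring R \<phi> U \<and>
              action_norm R (quotient_action \<phi>) (carrier (G Mod U)) a
                = gr_act R \<phi> (gr \<one>\<^bsub>G\<^esub> + gr \<sigma>) a \<and>
              gr_act R \<phi> (gr \<one>\<^bsub>G\<^esub> + gr \<sigma>) a = \<one>\<^bsub>R\<^esub> \<and>
              action_norm R \<phi> (carrier G) y = \<one>\<^bsub>R\<^esub>)"
    if R: "ring R" "acts_by_ring_automorphisms G R \<phi>" "x \<in> carrier R"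
      "action_norm R \<phi> U x = \<one>\<^bsub>R\<^esub>" "x2 \<in> carrier R" "action_norm R \<phi> U2 x2 = \<one>\<^bsub>R\<^esub>"
    and b: "b_sigma = gr_act R \<phi> (gr \<sigma> + gr (u \<otimes>\<^bsub>G\<^esub> \<tau>)) x2"
      "b_tau = gr_act R \<phi> (gr \<tau> - gr \<one>\<^bsub>G\<^esub>) (gr_act R \<phi> (gr \<one>\<^bsub>G\<^esub> + gr u) x2)"
      "b_sigma_sq = gr_act R \<phi> (gr \<one>\<^bsub>G\<^esub> + gr \<sigma>) b_sigma \<ominus>\<^bsub>R\<^esub> \<one>\<^bsub>R\<^esub>"
    for R :: "('r, 'k) ring_scheme" and \<phi> x x2 b_sigma b_tau b_sigma_sq
  proof -
    interpret Q: dihedral_norm_problem G \<sigma> \<tau> m R \<phi> x x2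
      using dih R even_m
      by (intro dihedral_norm_problem.intro dihedral_norm_problem_axioms.intro) (simp_all add: U U2)
    have one_plus: "gr_act R \<phi> (gr \<one>\<^bsub>G\<^esub> + gr g) r = r \<oplus>\<^bsub>R\<^esub> \<phi> g r"
      and minus_one: "gr_act R \<phi> (gr g - gr \<one>\<^bsub>G\<^esub>) r = \<phi> g r \<ominus>\<^bsub>R\<^esub> r"
      and one_minus: "gr_act R \<phi> (gr \<one>\<^bsub>G\<^esub> - gr g) r = r \<ominus>\<^bsub>R\<^esub> \<phi> g r"
      if "g \<in> carrier G" "r \<in> carrier R" for g r
      using that by (simp_all add: Q.R.gr_act_add Q.R.gr_act_diff Q.act_one)
    have bs: "b_sigma = Q.N.bs"
      by (simp add: b(1) u Q.R.gr_act_add Q.N.bs_def Q.act_act)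
    have bt: "b_tau = Q.N.bt"
      by (simp add: b(2) u one_plus minus_one Q.N.bt_def)
    have bss: "b_sigma_sq = Q.N.bss"
      by (simp add: b(3) bs one_plus Q.N.bss_def)
    have a: "b_sigma \<oplus>\<^bsub>R\<^esub> gr_act R \<phi> (gr \<one>\<^bsub>G\<^esub> - gr \<sigma>) Q.N.w = Q.N.a"
      by (simp add: bs one_minus Q.N.a_def)
    show ?thesis
    proof (intro bexI[of _ Q.N.w] conjI)
      show "Q.N.w = ncpoly_eval R (translate_val \<phi> x b_sigma b_tau) D.w_poly"
        by (simp add: bs bt Q.eval_w_poly)
      show "b_sigma_sq = gr_act R \<phi> (gr (\<sigma> [^]\<^bsub>G\<^esub> (2::nat)) - gr \<one>\<^bsub>G\<^esub>) Q.N.w"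
        by (simp add: bss sigma_sq minus_one Q.N.S_w Q.R.group_simps Q.R.a_comm)
      show "b_tau = gr_act R \<phi> (gr \<tau> - gr \<one>\<^bsub>G\<^esub>) Q.N.w"
        by (simp add: bt minus_one Q.N.T_w Q.R.group_simps Q.R.a_comm)
      show "let a = b_sigma \<oplus>\<^bsub>R\<^esub> gr_act R \<phi> (gr \<one>\<^bsub>G\<^esub> - gr \<sigma>) Q.N.w;
               y = a \<otimes>\<^bsub>R\<^esub> x
           in a \<in> fixed_subring R \<phi> U \<and>
              action_norm R (quotient_action \<phi>) (carrier (G Mod U)) a
                = gr_act R \<phi> (gr \<one>\<^bsub>G\<^esub> + gr \<sigma>) a \<and>
              gr_act R \<phi> (gr \<one>\<^bsub>G\<^esub> + gr \<sigma>) a = \<one>\<^bsub>R\<^esub> \<and>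
              action_norm R \<phi> (carrier G) y = \<one>\<^bsub>R\<^esub>"
        unfolding a Let_def U
        using Q.N.trace_a
        by (simp add: fixed_subring_def Q.act_U_a Q.quotient_norm_a Q.norm_G one_plus)
    qed simp
  qed
  ultimately show ?thesis
    by (intro exI[of _ D.w_poly]) simp
qed

end
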